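(* Let $M$ be a manifold (not necessarily compact) with a volume form $\omega$, and let $f:M\to M$ be a Lagrange-stable $\mathcal{C}^1$-diffeomorphism preserving $\omega$. Then $M$ is strongly chain recurrent for $f$, i.e., every point of $M$ is strongly chain recurrent with respect to $f$.
   Context: $M$ is an $n$-dimensional differentiable manifold with a metric $d$ inducing its topology. A volume form is a nowhere vanishing $n$-form; $f$ preserves $\omega$ if $f^*\omega=\omega$. Lagrange stability: $f$ is Lagrange-stable if for every $p\in M$ the set $K^+(p)=\overline{\{f^n(p): n\ge 0\}}$ is compact. Strong chain recurrence: let $\mathcal{P}$ be the set of continuous functions $\varepsilon: M\to(0,\infty)$. For $\varepsilon\in\mathcal{P}$, an $\varepsilon(x)$-chain of length $n$ is a sequence $x_0,x_1,\dots,x_n$ with $d(f(x_j),x_{j+1})<\varepsilon(f(x_j))$ for $0\le j\le n-1$. A point $p$ is strongly chain recurrent for $f$ if for every $\varepsilon\in\mathcal{P}$ there is an $\varepsilon(x)$-chain of length at least $1$ that begins and ends at $p$. *)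

theory Defs
  imports "HOL-Analysis.Analysis"
begin

text \<open>
  A manifold is a type of class \<^class>\<open>metric_space\<close> (so its topology is the one induced by the
  metric) together with an atlas, i.e. a set of charts \<open>(U, \<phi>)\<close> with values in \<open>\<real>\<^sup>n\<close>, where
  \<open>n = CARD('n)\<close>. Neither connectedness nor second countability is required.
  Atlases are of class \<open>C\<^sup>1\<close> and forms are continuous, the least regularity for which
  \<open>C\<^sup>1\<close>-diffeomorphisms and their action on forms make sense; smoother atlases and
  smoother forms are special cases.
\<close>

type_synonym ('a, 'n) chart = "'a set \<times> ('a \<Rightarrow> (real, 'n) vec)"

abbreviation chart_dom :: "('a, 'n::finite) chart \<Rightarrow> 'a set" where
  "chart_dom c \<equiv> fst c"

abbreviation chart_map :: "('a, 'n::finite) chart \<Rightarrow> 'a \<Rightarrow> real ^ 'n" where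
  "chart_map c \<equiv> snd c"

definition chart_inv :: "('a, 'n::finite) chart \<Rightarrow> real ^ 'n \<Rightarrow> 'a" where
  "chart_inv c = inv_into (chart_dom c) (chart_map c)"

definition is_chart :: "('a::topological_space, 'n::finite) chart \<Rightarrow> bool" where
  "is_chart c \<longleftrightarrow> open (chart_dom c) \<and> open (chart_map c ` chart_dom c) \<and>
     homeomorphism (chart_dom c) (chart_map c ` chart_dom c) (chart_map c) (chart_inv c)"

text \<open>Only used for open \<open>S\<close>.\<close>

definition C1_on :: "'e::real_normed_vector set \<Rightarrow> ('e \<Rightarrow> 'b::real_normed_vector) \<Rightarrow> bool" where
  "C1_on S g \<longleftrightarrow> (\<exists>g' :: 'e \<Rightarrow> 'e \<Rightarrow>\<^sub>L 'b.
     (\<forall>x\<in>S. (g has_derivative blinfun_apply (g' x)) (at x)) \<and> continuous_on S g')"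

definition C1_manifold :: "('a::metric_space, 'n::finite) chart set \<Rightarrow> bool" where
  "C1_manifold A \<longleftrightarrow>
     (\<forall>c\<in>A. is_chart c) \<and>
     (\<Union>c\<in>A. chart_dom c) = UNIV \<and>
     (\<forall>c\<in>A. \<forall>d\<in>A. C1_on (chart_map c ` (chart_dom c \<inter> chart_dom d)) (chart_map d \<circ> chart_inv c))"

definition C1_map :: "('a::metric_space, 'n::finite) chart set \<Rightarrow> ('a \<Rightarrow> 'a) \<Rightarrow> bool" where
  "C1_map A f \<longleftrightarrow> continuous_on UNIV f \<and>
     (\<forall>c\<in>A. \<forall>d\<in>A. C1_on (chart_map c ` (chart_dom c \<inter> f -` chart_dom d))
                        (chart_map d \<circ> f \<circ> chart_inv c))"

definition C1_diffeomorphism :: "('a::metric_space, 'n::finite) chart set \<Rightarrow> ('a \<Rightarrow> 'a) \<Rightarrow> bool" where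
  "C1_diffeomorphism A f \<longleftrightarrow> bij f \<and> C1_map A f \<and> C1_map A (inv f)"

definition charts_at :: "('a, 'n::finite) chart set \<Rightarrow> 'a \<Rightarrow> ('a, 'n) chart set" where
  "charts_at A p = {c \<in> A. p \<in> chart_dom c}"

text \<open>
  A tangent vector at \<open>p\<close> is the family of its coordinate vectors, one for each chart
  around \<open>p\<close>, related by the derivatives of the coordinate changes. The value \<open>0\<close> at all
  other charts is a convention that makes the representation unique.
\<close>

type_synonym ('a, 'n) tangent_vector = "('a, 'n) chart \<Rightarrow> (real, 'n) vec"

definition tangent_space ::
  "('a, 'n::finite) chart set \<Rightarrow> 'a \<Rightarrow> ('a, 'n) tangent_vector set" where
  "tangent_space A p = {v.
     (\<forall>c\<in>charts_at A p. \<forall>d\<in>charts_at A p.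
        v d = frechet_derivative (chart_map d \<circ> chart_inv c) (at (chart_map c p)) (v c)) \<and>
     (\<forall>c. c \<notin> charts_at A p \<longrightarrow> v c = 0)}"

text \<open>The tangent vector at \<open>p\<close> whose coordinate vector in the chart \<open>c\<close> is \<open>u\<close>.\<close>

definition coord_vector ::
  "('a, 'n::finite) chart set \<Rightarrow> ('a, 'n) chart \<Rightarrow> 'a \<Rightarrow> real ^ 'n \<Rightarrow> ('a, 'n) tangent_vector" where
  "coord_vector A c p u = (\<lambda>d. if d \<in> charts_at A p
     then frechet_derivative (chart_map d \<circ> chart_inv c) (at (chart_map c p)) u else 0)"

text \<open>By the chain rule the choice of the chart \<open>c\<close> around \<open>p\<close> is immaterial.\<close>

definition differential ::
  "('a, 'n::finite) chart set \<Rightarrow> ('a \<Rightarrow> 'a) \<Rightarrow> 'a \<Rightarrow> ('a, 'n) tangent_vector \<Rightarrow> ('a, 'n) tangent_vector"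
  where
  "differential A f p v = (\<lambda>d. if d \<in> charts_at A (f p)
     then (let c = SOME c. c \<in> charts_at A p in
             frechet_derivative (chart_map d \<circ> f \<circ> chart_inv c) (at (chart_map c p)) (v c))
     else 0)"

text \<open>
  A form of top degree \<open>n\<close> takes \<open>n\<close> tangent vectors, indexed by the type \<open>'n\<close>; only its
  values on tuples from \<open>tangent_space A p\<close> are meaningful.
\<close>

type_synonym ('a, 'n) top_form = "'a \<Rightarrow> ('n \<Rightarrow> ('a, 'n) tangent_vector) \<Rightarrow> real"

definition tangent_tuples ::
  "('a, 'n::finite) chart set \<Rightarrow> 'a \<Rightarrow> ('n \<Rightarrow> ('a, 'n) tangent_vector) set" where
  "tangent_tuples A p = {v. \<forall>i. v i \<in> tangent_space A p}"

definition alternating_multilinear_at ::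
  "('a, 'n::finite) chart set \<Rightarrow> 'a \<Rightarrow> (('n \<Rightarrow> ('a, 'n) tangent_vector) \<Rightarrow> real) \<Rightarrow> bool" where
  "alternating_multilinear_at A p \<alpha> \<longleftrightarrow>
     (\<forall>v\<in>tangent_tuples A p. \<forall>i. \<forall>x\<in>tangent_space A p. \<forall>y\<in>tangent_space A p. \<forall>a b.
        \<alpha> (v(i := (\<lambda>c. a *\<^sub>R x c + b *\<^sub>R y c))) = a * \<alpha> (v(i := x)) + b * \<alpha> (v(i := y))) \<and>
     (\<forall>v\<in>tangent_tuples A p. \<forall>i j. i \<noteq> j \<and> v i = v j \<longrightarrow> \<alpha> v = 0)"

text \<open>Continuity of a form means continuity of its coefficient in every chart.\<close>

definition continuous_top_form ::
  "('a::metric_space, 'n::finite) chart set \<Rightarrow> ('a, 'n) top_form \<Rightarrow> bool" where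
  "continuous_top_form A \<omega> \<longleftrightarrow>
     (\<forall>p. alternating_multilinear_at A p (\<omega> p)) \<and>
     (\<forall>c\<in>A. continuous_on (chart_dom c) (\<lambda>p. \<omega> p (\<lambda>i. coord_vector A c p (axis i 1))))"

definition volume_form ::
  "('a::metric_space, 'n::finite) chart set \<Rightarrow> ('a, 'n) top_form \<Rightarrow> bool" where
  "volume_form A \<omega> \<longleftrightarrow> continuous_top_form A \<omega> \<and> (\<forall>p. \<exists>v\<in>tangent_tuples A p. \<omega> p v \<noteq> 0)"

definition pullback ::
  "('a, 'n::finite) chart set \<Rightarrow> ('a \<Rightarrow> 'a) \<Rightarrow> ('a, 'n) top_form \<Rightarrow> ('a, 'n) top_form" where
  "pullback A f \<omega> = (\<lambda>p v. \<omega> (f p) (\<lambda>i. differential A f p (v i)))"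

definition preserves_form ::
  "('a, 'n::finite) chart set \<Rightarrow> ('a \<Rightarrow> 'a) \<Rightarrow> ('a, 'n) top_form \<Rightarrow> bool" where
  "preserves_form A f \<omega> \<longleftrightarrow> (\<forall>p. \<forall>v\<in>tangent_tuples A p. pullback A f \<omega> p v = \<omega> p v)"

definition Lagrange_stable :: "('a::topological_space \<Rightarrow> 'a) \<Rightarrow> bool" where
  "Lagrange_stable f \<longleftrightarrow> (\<forall>p. compact (closure {(f ^^ n) p |n. n \<ge> 0}))"

definition eps_chain ::
  "('a::metric_space \<Rightarrow> 'a) \<Rightarrow> ('a \<Rightarrow> real) \<Rightarrow> nat \<Rightarrow> (nat \<Rightarrow> 'a) \<Rightarrow> bool" where
  "eps_chain f \<epsilon> n x \<longleftrightarrow> (\<forall>j<n. dist (f (x j)) (x (Suc j)) < \<epsilon> (f (x j)))"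

definition strongly_chain_recurrent :: "('a::metric_space \<Rightarrow> 'a) \<Rightarrow> 'a \<Rightarrow> bool" where
  "strongly_chain_recurrent f p \<longleftrightarrow>
     (\<forall>\<epsilon>. continuous_on UNIV \<epsilon> \<and> (\<forall>x. 0 < \<epsilon> x) \<longrightarrow>
        (\<exists>n\<ge>1. \<exists>x. eps_chain f \<epsilon> n x \<and> x 0 = p \<and> x n = p))"

end

theory Submission
  imports Defs
begin

text \<open>
  This is Poincare recurrence, where Lagrange stability replaces finiteness of the volume.

  If every neighbourhood \<open>U\<close> of \<open>p\<close> contains a point \<open>q\<close> with \<open>(f ^^ k) q \<in> U\<close> for some
  \<open>k \<ge> 2\<close>, then \<open>p, f q, \<dots>, (f ^^ (k - 1)) q, p\<close> is an \<open>\<epsilon>\<close>-chain as soon as \<open>U\<close> is small,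
  because only its first and its last step are not exact
  (\<open>strongly_chain_recurrent_if_returns\<close>). So it suffices to find such returns.

  Every orbit that starts in a small compact neighbourhood \<open>C\<close> of \<open>p\<close> stays in a compact set.
  All these orbits together lie in the closure of a countable set, so countably many compact
  pieces of charts cover all of them, each orbit being covered by finitely many. There are only
  countably many finite selections of pieces and \<open>C\<close> has positive volume, hence some compact
  \<open>E \<subseteq> C\<close> of positive volume has all its images in one and the same finite union of compact
  pieces (\<open>bounded_orbits_of_positive_volume\<close>). If no point of \<open>U\<close> returned to \<open>U\<close> after
  time \<open>N\<close>, the images of \<open>E\<close> at suitably spaced times would be infinitely many disjoint sets
  of equal positive volume inside a set of finite volume, which is impossible
  (\<open>returns_to_open_set\<close>).

  The volume of the manifold is never constructed. In place of it serve the Lebesgue measures of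
  the coordinate images of compact sets. The form is preserved, so the Jacobian of an
  iterate in charts is the quotient of the coefficients of \<open>\<omega>\<close> at a point and at its image
  (\<open>preserves_coeff\<close>), and this quotient is bounded between compact pieces of two charts. Hence
  all iterates distort Lebesgue measure by at most a common factor (\<open>measure_chart_image_le\<close>),
  which is enough for the packing argument.
\<close>

section \<open>Alternating multilinear functions and determinants\<close>

definition alternating_multilinear :: "(('n \<Rightarrow> 'v::real_vector) \<Rightarrow> real) \<Rightarrow> bool" where
  "alternating_multilinear \<alpha> \<longleftrightarrow>
     (\<forall>v i x y a b. \<alpha> (v(i := a *\<^sub>R x + b *\<^sub>R y)) = a * \<alpha> (v(i := x)) + b * \<alpha> (v(i := y))) \<and>
     (\<forall>v i j. i \<noteq> j \<and> v i = v j \<longrightarrow> \<alpha> v = 0)"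

lemma alternating_multilinear_comb:
  "alternating_multilinear \<alpha> \<Longrightarrow>
     \<alpha> (v(i := a *\<^sub>R x + b *\<^sub>R y)) = a * \<alpha> (v(i := x)) + b * \<alpha> (v(i := y))"
  unfolding alternating_multilinear_def by blast

lemma alternating_multilinear_eq_0:
  "alternating_multilinear \<alpha> \<Longrightarrow> i \<noteq> j \<Longrightarrow> v i = v j \<Longrightarrow> \<alpha> v = 0"
  unfolding alternating_multilinear_def by blast

lemma alternating_multilinear_add:
  "alternating_multilinear \<alpha> \<Longrightarrow> \<alpha> (v(i := x + y)) = \<alpha> (v(i := x)) + \<alpha> (v(i := y))"
  using alternating_multilinear_comb[of \<alpha> v i 1 x 1 y] by simp

lemma alternating_multilinear_scale:
  "alternating_multilinear \<alpha> \<Longrightarrow> \<alpha> (v(i := a *\<^sub>R x)) = a * \<alpha> (v(i := x))"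
  using alternating_multilinear_comb[of \<alpha> v i a x 0 x] by simp

lemma alternating_multilinear_transpose:
  assumes \<alpha>: "alternating_multilinear \<alpha>" and "m \<noteq> n"
  shows "\<alpha> (v \<circ> Transposition.transpose m n) = - \<alpha> v"
proof -
  let ?w = "\<lambda>x y. v(m := x, n := y)"
  have eq0: "\<alpha> (?w x x) = 0" for x
    using alternating_multilinear_eq_0[OF \<alpha> \<open>m \<noteq> n\<close>, of "?w x x"] \<open>m \<noteq> n\<close> by simp
  have addn: "\<alpha> (?w x (y + z)) = \<alpha> (?w x y) + \<alpha> (?w x z)" for x y z
    by (rule alternating_multilinear_add[OF \<alpha>])
  have addm: "\<alpha> (?w (x + y) z) = \<alpha> (?w x z) + \<alpha> (?w y z)" for x y z
    using alternating_multilinear_add[OF \<alpha>, of "v(n := z)" m x y] \<open>m \<noteq> n\<close>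
    by (simp add: fun_upd_twist)
  have "\<alpha> (?w (v m) (v n)) + \<alpha> (?w (v n) (v m)) = 0"
    (* polarization: the form vanishes with v m + v n in both slots *)
    using eq0[of "v m + v n"] eq0[of "v m"] eq0[of "v n"] unfolding addn addm by linarith
  moreover have "v \<circ> Transposition.transpose m n = ?w (v n) (v m)"
    using \<open>m \<noteq> n\<close> by (auto simp: fun_eq_iff Transposition.transpose_def)
  ultimately show ?thesis
    by simp
qed

lemma alternating_multilinear_diagonal:
  assumes \<alpha>: "alternating_multilinear \<alpha>" and "finite S"
  shows "\<alpha> (\<lambda>i. if i \<in> S then c i *\<^sub>R v i else v i) = (\<Prod>i\<in>S. c i) * \<alpha> v"
  using \<open>finite S\<close>
proof induction
  case (insert s S)
  let ?w = "\<lambda>i. if i \<in> S then c i *\<^sub>R v i else v i"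
  have "(\<lambda>i. if i \<in> insert s S then c i *\<^sub>R v i else v i) = ?w(s := c s *\<^sub>R v s)"
    using insert by (auto simp: fun_eq_iff)
  moreover have "?w(s := v s) = ?w"
    using insert by (auto simp: fun_eq_iff)
  ultimately show ?case
    using insert by (simp add: alternating_multilinear_scale[OF \<alpha>])
qed simp

text \<open>
  The set of matrices that satisfy the formula for all \<open>v\<close> is closed under products, so it is
  enough to treat elementary matrices.
\<close>

lemma alternating_multilinear_matrix:
  fixes \<alpha> :: "('n::finite \<Rightarrow> 'v::real_vector) \<Rightarrow> real" and M :: "real^'n^'n"
  assumes \<alpha>: "alternating_multilinear \<alpha>"
  shows "\<alpha> (\<lambda>i. \<Sum>j\<in>UNIV. M $ i $ j *\<^sub>R v j) = det M * \<alpha> v"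
proof -
  let ?P = "\<lambda>M. \<forall>v. \<alpha> (\<lambda>i. \<Sum>j\<in>UNIV. M $ i $ j *\<^sub>R v j) = det M * \<alpha> v"
  have "?P M"
  proof (rule induct_matrix_elementary)
    fix A B :: "real^'n^'n"
    assume A: "?P A" and B: "?P B"
    show "?P (A ** B)"
    proof
      fix v :: "'n \<Rightarrow> 'v"
      let ?w = "\<lambda>k. \<Sum>j\<in>UNIV. B $ k $ j *\<^sub>R v j"
      have "(\<Sum>j\<in>UNIV. (A ** B) $ i $ j *\<^sub>R v j) = (\<Sum>k\<in>UNIV. A $ i $ k *\<^sub>R ?w k)" for i
      proof -
        have "(\<Sum>j\<in>UNIV. (A ** B) $ i $ j *\<^sub>R v j) =
            (\<Sum>j\<in>UNIV. \<Sum>k\<in>UNIV. (A $ i $ k * B $ k $ j) *\<^sub>R v j)"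
          unfolding matrix_matrix_mult_def vec_lambda_beta
          by (intro sum.cong refl scaleR_sum_left)
        also have "\<dots> = (\<Sum>k\<in>UNIV. A $ i $ k *\<^sub>R ?w k)"
          by (subst sum.swap) (simp add: scaleR_sum_right)
        finally show ?thesis .
      qed
      then show "\<alpha> (\<lambda>i. \<Sum>j\<in>UNIV. (A ** B) $ i $ j *\<^sub>R v j) = det (A ** B) * \<alpha> v"
        using A B by (simp add: det_mul)
    qed
  next
    fix A :: "real^'n^'n" and i
    assume 0: "row i A = 0"
    then have A0: "A $ i $ j = 0" for j
      by (metis row_def vec_lambda_eta zero_index)
    show "?P A"
    proof
      fix v :: "'n \<Rightarrow> 'v"
      let ?w = "\<lambda>i. \<Sum>j\<in>UNIV. A $ i $ j *\<^sub>R v j"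
      have "?w = ?w(i := 0 *\<^sub>R 0)"
        by (auto simp: fun_eq_iff A0)
      then have "\<alpha> ?w = 0"
        using alternating_multilinear_scale[OF \<alpha>, of ?w i 0 0] by simp
      then show "\<alpha> ?w = det A * \<alpha> v"
        using 0 by (simp add: det_zero_row)
    qed
  next
    fix A :: "real^'n^'n"
    assume A: "\<And>i j. i \<noteq> j \<Longrightarrow> A $ i $ j = 0"
    show "?P A"
    proof
      fix v :: "'n \<Rightarrow> 'v"
      have "(\<Sum>j\<in>UNIV. A $ i $ j *\<^sub>R v j) = A $ i $ i *\<^sub>R v i" for i
        using sum.remove[of UNIV i "\<lambda>j. A $ i $ j *\<^sub>R v j"] A by simp
      then show "\<alpha> (\<lambda>i. \<Sum>j\<in>UNIV. A $ i $ j *\<^sub>R v j) = det A * \<alpha> v"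
        using alternating_multilinear_diagonal[OF \<alpha>, of UNIV "\<lambda>i. A $ i $ i" v]
        by (simp add: det_diagonal A)
    qed
  next
    fix m n :: 'n
    assume "m \<noteq> n"
    let ?T = "\<chi> i j. mat 1 $ i $ Transposition.transpose m n j :: real^'n^'n"
    have det: "det ?T = -1"
      using det_permute_columns[of "Transposition.transpose m n" "mat 1 :: real^'n^'n"] \<open>m \<noteq> n\<close>
      by (simp add: permutes_swap_id sign_swap_id)
    show "?P ?T"
    proof
      fix v :: "'n \<Rightarrow> 'v"
      have "(\<Sum>j\<in>UNIV. ?T $ i $ j *\<^sub>R v j) = (v \<circ> Transposition.transpose m n) i" for i
      proof -
        have "(\<Sum>j\<in>UNIV. ?T $ i $ j *\<^sub>R v j) =
            (\<Sum>j\<in>UNIV. if j = Transposition.transpose m n i then v j else 0)"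
          by (intro sum.cong) (auto simp: mat_def Transposition.transpose_def)
        then show ?thesis
          by simp
      qed
      then show "\<alpha> (\<lambda>i. \<Sum>j\<in>UNIV. ?T $ i $ j *\<^sub>R v j) = det ?T * \<alpha> v"
        using alternating_multilinear_transpose[OF \<alpha> \<open>m \<noteq> n\<close>, of v] by (simp add: det o_def)
    qed
  next
    fix m n :: 'n and c :: real
    assume "m \<noteq> n"
    let ?T = "\<chi> i j. if i = m \<and> j = n then c else of_bool (i = j) :: real^'n^'n"
    have "?T = (\<chi> k. if k = m then row m (mat 1) + c *s row n (mat 1) else row k (mat 1))"
      using \<open>m \<noteq> n\<close> by (auto simp: vec_eq_iff row_def mat_def)
    then have det: "det ?T = 1"
      using det_row_operation[OF \<open>m \<noteq> n\<close>, of "mat 1 :: real^'n^'n" c] by simp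
    show "?P ?T"
    proof
      fix v :: "'n \<Rightarrow> 'v"
      have "(\<Sum>j\<in>UNIV. ?T $ i $ j *\<^sub>R v j) = (v(m := 1 *\<^sub>R v m + c *\<^sub>R v n)) i" for i
      proof -
        have "(\<Sum>j\<in>UNIV. ?T $ i $ j *\<^sub>R v j) =
            (\<Sum>j\<in>UNIV. (if j = i then v j else 0) + (if j = n then if i = m then c *\<^sub>R v j else 0 else 0))"
          using \<open>m \<noteq> n\<close> by (intro sum.cong) auto
        also have "\<dots> = v i + (if i = m then c *\<^sub>R v n else 0)"
          by (simp add: sum.distrib)
        finally show ?thesis
          by simp
      qed
      then have "(\<lambda>i. \<Sum>j\<in>UNIV. ?T $ i $ j *\<^sub>R v j) = v(m := 1 *\<^sub>R v m + c *\<^sub>R v n)"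
        by (rule ext)
      then have "\<alpha> (\<lambda>i. \<Sum>j\<in>UNIV. ?T $ i $ j *\<^sub>R v j) = \<alpha> v + c * \<alpha> (v(m := v n))"
        by (simp only: alternating_multilinear_comb[OF \<alpha>]) simp
      also have "\<alpha> (v(m := v n)) = 0"
        using alternating_multilinear_eq_0[OF \<alpha> \<open>m \<noteq> n\<close>] \<open>m \<noteq> n\<close> by simp
      finally show "\<alpha> (\<lambda>i. \<Sum>j\<in>UNIV. ?T $ i $ j *\<^sub>R v j) = det ?T * \<alpha> v"
        by (simp add: det)
    qed
  qed
  then show ?thesis
    by blast
qed

lemma alternating_multilinear_linear_image:
  fixes \<alpha> :: "('n::finite \<Rightarrow> real^'n) \<Rightarrow> real" and L :: "real^'n \<Rightarrow> real^'n"
  assumes \<alpha>: "alternating_multilinear \<alpha>"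
  shows "\<alpha> (\<lambda>i. L (axis i 1)) = det (matrix L) * \<alpha> (\<lambda>i. axis i 1)"
proof -
  have "L (axis i 1) = (\<Sum>j\<in>UNIV. transpose (matrix L) $ i $ j *\<^sub>R axis j 1)" for i
    by (simp add: vec_eq_iff matrix_def transpose_def axis_def if_distrib cong: if_cong)
  then show ?thesis
    using alternating_multilinear_matrix[OF \<alpha>, of "transpose (matrix L)" "\<lambda>j. axis j 1"] by simp
qed

section \<open>Transporting Euclidean space to a well-ordered index type\<close>

text \<open>
  The estimates for the measure of differentiable images are about \<open>real ^ 'm\<close> with a
  well-ordered \<open>'m\<close>, whereas the dimension type of a manifold is just finite. This type has as
  many elements as \<open>'n\<close> and inherits the order of the natural numbers; renaming coordinates by a
  bijection carries the estimates over to \<open>real ^ 'n\<close>.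
\<close>

typedef 'n index_copy = "{..<CARD('n::finite)}"
  by (auto intro!: exI[of _ 0])

instance index_copy :: (finite) finite
proof
  have "range (Abs_index_copy :: nat \<Rightarrow> 'a index_copy) = UNIV \<and>
      Abs_index_copy ` {..<CARD('a)} = (UNIV :: 'a index_copy set)"
    using type_definition.Abs_image[OF type_definition_index_copy] by auto
  then show "finite (UNIV :: 'a index_copy set)"
    by (metis finite_imageI finite_lessThan)
qed

lemma card_index_copy: "CARD('n::finite index_copy) = CARD('n)"
  using type_definition.card[OF type_definition_index_copy] by simp

instantiation index_copy :: (finite) wellorder
begin

definition less_eq_index_copy :: "'a index_copy \<Rightarrow> 'a index_copy \<Rightarrow> bool" where
  "i \<le> j \<longleftrightarrow> Rep_index_copy i \<le> Rep_index_copy j"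

definition less_index_copy :: "'a index_copy \<Rightarrow> 'a index_copy \<Rightarrow> bool" where
  "i < j \<longleftrightarrow> Rep_index_copy i < Rep_index_copy j"

instance
proof
  fix P :: "'a index_copy \<Rightarrow> bool" and i
  assume step: "\<And>x. (\<And>y. y < x \<Longrightarrow> P y) \<Longrightarrow> P x"
  show "P i"
    by (induction i rule: measure_induct_rule[of Rep_index_copy])
      (auto intro: step simp: less_index_copy_def)
qed (auto simp: less_eq_index_copy_def less_index_copy_def Rep_index_copy_inject)

end

definition reindex :: "('m \<Rightarrow> 'n) \<Rightarrow> real^'n \<Rightarrow> real^'m" where
  "reindex e x = (\<chi> i. x $ e i)"

lemma reindex_nth [simp]: "reindex e x $ i = x $ e i"
  by (simp add: reindex_def)

lemma linear_reindex: "linear (reindex e :: real^'n::finite \<Rightarrow> real^'m::finite)"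
  by (rule linearI) (simp_all add: vec_eq_iff)

lemma bounded_linear_reindex: "bounded_linear (reindex e :: real^'n::finite \<Rightarrow> real^'m::finite)"
  by (intro linear_conv_bounded_linear[THEN iffD1] linear_reindex)

lemma continuous_on_reindex: "continuous_on S (reindex e :: real^'n::finite \<Rightarrow> real^'m::finite)"
  by (intro linear_continuous_on bounded_linear_reindex)

lemma reindex_inv:
  assumes "bij e"
  shows "reindex (inv e) (reindex e x) = x" "reindex e (reindex (inv e) y) = y"
  using assms by (simp_all add: vec_eq_iff surj_f_inv_f bij_is_surj inv_f_f bij_is_inj)

text \<open>
  For a function \<open>v\<close> on the old index type, the determinant of the matrix whose rows are the
  reindexed vectors \<open>v (e i)\<close> is alternating and multilinear in \<open>v\<close>. Its values at the standard
  basis and at the image of the standard basis under \<open>L\<close> are \<open>1\<close> and the left-hand side.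
\<close>

lemma det_reindex:
  fixes e :: "'m::finite \<Rightarrow> 'n::finite" and L :: "real^'n \<Rightarrow> real^'n"
  assumes e: "bij e"
  shows "det (matrix (reindex e \<circ> L \<circ> reindex (inv e))) = det (matrix L)"
proof -
  let ?\<alpha> = "\<lambda>v :: 'n \<Rightarrow> real^'n. det (\<chi> i. reindex e (v (e i)) :: real^'m^'m)"
  have "alternating_multilinear ?\<alpha>"
    unfolding alternating_multilinear_def
  proof (intro conjI allI impI)
    fix v :: "'n \<Rightarrow> real^'n" and k x y and a b :: real
    have upd: "?\<alpha> (v(k := z)) = det (\<chi> i. if i = inv e k then reindex e z else reindex e (v (e i)))" for z
      using e by (intro arg_cong[where f = det])
        (auto simp: vec_eq_iff bij_inv_eq_iff bij_is_surj surj_f_inv_f)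
    have "reindex e (a *\<^sub>R x + b *\<^sub>R y) = a *s reindex e x + b *s reindex e y"
      by (simp add: vec_eq_iff)
    then show "?\<alpha> (v(k := a *\<^sub>R x + b *\<^sub>R y)) = a * ?\<alpha> (v(k := x)) + b * ?\<alpha> (v(k := y))"
      unfolding upd
      using det_row_add[of "inv e k" "\<lambda>_. a *s reindex e x" "\<lambda>_. b *s reindex e y" "\<lambda>i. reindex e (v (e i))"]
      by (simp only: det_row_mul simp_thms \<open>reindex e (a *\<^sub>R x + b *\<^sub>R y) = _\<close>)
  next
    fix v :: "'n \<Rightarrow> real^'n" and i j
    assume "i \<noteq> j \<and> v i = v j"
    then show "?\<alpha> v = 0"
      using e by (intro det_identical_rows[of "inv e i" "inv e j"])
        (auto simp: row_def vec_eq_iff bij_is_surj surj_f_inv_f inv_into_injective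
          bij_inv_eq_iff)
  qed
  then have "?\<alpha> (\<lambda>i. L (axis i 1)) = det (matrix L) * ?\<alpha> (\<lambda>i. axis i 1)"
    by (rule alternating_multilinear_linear_image)
  moreover have "?\<alpha> (\<lambda>i. axis i 1) = 1"
  proof -
    have "(\<chi> i. reindex e (axis (e i) 1)) = (mat 1 :: real^'m^'m)"
      using e by (auto simp: vec_eq_iff mat_def axis_def dest: bij_is_inj injD)
    then show ?thesis
      by simp
  qed
  moreover have "?\<alpha> (\<lambda>i. L (axis i 1)) = det (transpose (matrix (reindex e \<circ> L \<circ> reindex (inv e))))"
  proof -
    have "reindex (inv e) (axis i 1) = axis (e i) (1::real)" for i
      using e by (auto simp: vec_eq_iff axis_def bij_is_inj bij_is_surj inv_f_f surj_f_inv_f)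
    then have "(\<chi> i. reindex e (L (axis (e i) 1))) =
        transpose (matrix (reindex e \<circ> L \<circ> reindex (inv e)))"
      by (simp add: transpose_def matrix_def reindex_def)
    then show ?thesis
      by simp
  qed
  ultimately show ?thesis
    by simp
qed

lemma Basis_vec_real: "(Basis :: (real^'n::finite) set) = range (\<lambda>i. axis i 1)"
  by (auto simp: Basis_vec_def)

lemma prod_Basis_vec_real: "(\<Prod>b\<in>Basis. (w :: real^'n::finite) \<bullet> b) = (\<Prod>i\<in>UNIV. w $ i)"
proof -
  have "inj (\<lambda>i::'n. axis i (1::real))"
    by (auto simp: inj_on_def axis_eq_axis)
  then show ?thesis
    by (simp add: Basis_vec_real prod.reindex inner_axis)
qed

lemma lborel_distr_reindex:
  fixes e :: "'m::finite \<Rightarrow> 'n::finite"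
  assumes e: "bij e"
  shows "lborel = distr lborel borel (reindex e :: real^'n \<Rightarrow> real^'m)"
proof (rule lborel_eqI)
  let ?R = "reindex e :: real^'n \<Rightarrow> real^'m"
  have meas: "?R \<in> measurable lborel borel"
    by (simp add: borel_measurable_continuous_onI continuous_on_reindex)
  fix l u :: "real^'m"
  assume le: "\<And>b. b \<in> Basis \<Longrightarrow> l \<bullet> b \<le> u \<bullet> b"
  have lu: "l $ i \<le> u $ i" for i
    using le[of "axis i 1"] by (simp add: Basis_vec_real inner_axis)
  have vimage: "?R -` box l u = box (reindex (inv e) l) (reindex (inv e) u)"
  proof -
    have "(\<forall>i. l $ i < x $ e i \<and> x $ e i < u $ i) \<longleftrightarrow>
        (\<forall>j. l $ inv e j < x $ j \<and> x $ j < u $ inv e j)" for x :: "real^'n"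
      using e by (metis bij_inv_eq_iff)
    then show ?thesis
      by (simp add: mem_box_cart set_eq_iff)
  qed
  have "emeasure (distr lborel borel ?R) (box l u) =
      emeasure lborel (box (reindex (inv e) l) (reindex (inv e) u))"
    by (simp add: emeasure_distr[OF meas] vimage)
  also have "\<dots> = ennreal (\<Prod>b\<in>Basis. (reindex (inv e) u - reindex (inv e) l) \<bullet> b)"
    by (rule emeasure_lborel_box) (auto simp: Basis_vec_real inner_axis lu)
  also have "(\<Prod>b\<in>Basis. (reindex (inv e) u - reindex (inv e) l) \<bullet> b) =
      (\<Prod>i\<in>UNIV. (u - l) $ inv e i)"
    unfolding prod_Basis_vec_real by simp
  also have "\<dots> = (\<Prod>i\<in>UNIV. (u - l) $ i)"
    by (rule prod.reindex_bij_betw[OF bij_imp_bij_inv[OF e]])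
  also have "\<dots> = (\<Prod>b\<in>Basis. (u - l) \<bullet> b)"
    unfolding prod_Basis_vec_real ..
  finally show "emeasure (distr lborel borel ?R) (box l u) = (\<Prod>b\<in>Basis. (u - l) \<bullet> b)" .
qed simp

lemma measure_reindex_image:
  fixes e :: "'m::finite \<Rightarrow> 'n::finite" and S :: "(real^'n) set"
  assumes e: "bij e" and "compact S"
  shows "measure lebesgue (reindex e ` S) = measure lebesgue S"
proof -
  have meas: "(reindex e :: real^'n \<Rightarrow> real^'m) \<in> measurable lborel borel"
    by (simp add: borel_measurable_continuous_onI continuous_on_reindex)
  have "compact (reindex e ` S)"
    using \<open>compact S\<close> by (intro compact_continuous_image continuous_on_reindex)
  then have borel: "reindex e ` S \<in> sets borel" "S \<in> sets borel"
    using \<open>compact S\<close> by (auto intro: borel_compact)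
  have "measure lebesgue (reindex e ` S) = measure (distr lborel borel (reindex e)) (reindex e ` S)"
    using borel lborel_distr_reindex[OF e] by simp
  also have "\<dots> = measure lborel (reindex e -` reindex e ` S \<inter> space lborel)"
    using borel by (intro measure_distr[OF meas]) auto
  also have "reindex e -` reindex e ` S \<inter> space lborel = S"
    by (auto, metis e reindex_inv(1))
  finally show ?thesis
    using borel by simp
qed

text \<open>
  The bound for maps between spaces with a well-ordered index type, carried over by \<open>reindex\<close>.
  Continuity of the Jacobian determinant on a compact set provides its integrability; for a map
  that preserves a form this determinant is a quotient of continuous coefficients.
\<close>

lemma measure_differentiable_image_le:
  fixes g :: "real^'n::finite \<Rightarrow> real^'n"
  assumes S: "compact S"
    and g: "\<And>x. x \<in> S \<Longrightarrow> (g has_derivative L x) (at x within S)"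
    and cont: "continuous_on S (\<lambda>x. \<bar>det (matrix (L x))\<bar>)"
    and bound: "\<And>x. x \<in> S \<Longrightarrow> \<bar>det (matrix (L x))\<bar> \<le> b"
  shows "measure lebesgue (g ` S) \<le> b * measure lebesgue S"
proof -
  obtain e :: "'n index_copy \<Rightarrow> 'n" where e: "bij e"
    using finite_same_card_bij[of "UNIV :: 'n index_copy set" "UNIV :: 'n set"]
    by (auto simp: card_index_copy)
  let ?R = "reindex e" and ?R' = "reindex (inv e)"
  define T where "T = ?R ` S"
  define h where "h = ?R \<circ> g \<circ> ?R'"
  define L' where "L' y = ?R \<circ> L (?R' y) \<circ> ?R'" for y
  have R'T: "?R' ` T = S"
    by (force simp: T_def reindex_inv[OF e])
  have det: "\<bar>det (matrix (L' y))\<bar> = \<bar>det (matrix (L (?R' y)))\<bar>" for y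
    by (simp add: L'_def det_reindex[OF e])
  have T: "compact T"
    unfolding T_def using S continuous_on_reindex by (rule compact_continuous_image[rotated])
  have cont': "continuous_on T (\<lambda>y. \<bar>det (matrix (L' y))\<bar>)"
    unfolding det by (rule continuous_on_compose2[OF cont continuous_on_reindex]) (simp add: R'T)
  have deriv: "(h has_derivative L' y) (at y within T)" if "y \<in> T" for y
  proof -
    have y: "?R' y \<in> S"
      using that R'T by blast
    have R: "(reindex e' has_derivative reindex e') F" for e' :: "'k::finite \<Rightarrow> 'l::finite" and F
      by (intro bounded_linear_imp_has_derivative bounded_linear_reindex)
    have "(g \<circ> ?R' has_derivative L (?R' y) \<circ> ?R') (at y within T)"
      using g[OF y] by (intro diff_chain_within[OF R]) (simp add: R'T)
    then show ?thesis
      unfolding h_def L'_def comp_assoc by (rule diff_chain_within[OF _ R])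
  qed
  have "measure lebesgue (h ` T) \<le> b * measure lebesgue T"
  proof (rule measure_bounded_differentiable_image[OF _ deriv])
    show "T \<in> lmeasurable"
      using T by (rule lmeasurable_compact)
    show "(\<lambda>y. \<bar>det (matrix (L' y))\<bar>) integrable_on T"
      using borel_integrable_compact[OF T cont']
      by (intro set_borel_integral_eq_integral(1)) (simp add: set_integrable_def)
    show "\<bar>det (matrix (L' y))\<bar> \<le> b" if "y \<in> T" for y
      using bound[of "?R' y"] that R'T by (auto simp: det)
  qed
  moreover have "measure lebesgue (h ` T) = measure lebesgue (g ` S)"
  proof -
    have "compact (g ` S)"
      using S g by (intro compact_continuous_image)
        (auto simp: continuous_on_eq_continuous_within intro: has_derivative_continuous)
    moreover have "h ` T = ?R ` (g ` S)"
      unfolding h_def by (simp only: image_comp[symmetric] R'T)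
    ultimately show ?thesis
      by (simp add: measure_reindex_image[OF e])
  qed
  moreover have "measure lebesgue T = measure lebesgue S"
    unfolding T_def using S by (rule measure_reindex_image[OF e])
  ultimately show ?thesis
    by simp
qed

section \<open>Maps in charts\<close>

definition in_charts :: "('a, 'n::finite) chart \<Rightarrow> ('a, 'n) chart \<Rightarrow> ('a \<Rightarrow> 'a) \<Rightarrow> real^'n \<Rightarrow> real^'n" where
  "in_charts c d g = chart_map d \<circ> g \<circ> chart_inv c"

lemma in_charts_id: "in_charts c d (\<lambda>x. x) = chart_map d \<circ> chart_inv c"
  by (auto simp: in_charts_def)

lemma chart_inv_chart_map:
  assumes "is_chart c" "p \<in> chart_dom c"
  shows "chart_inv c (chart_map c p) = p"
  using assms unfolding is_chart_def homeomorphism_def by blast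

lemma continuous_on_chart_map: "is_chart c \<Longrightarrow> continuous_on (chart_dom c) (chart_map c)"
  unfolding is_chart_def homeomorphism_def by blast

lemma continuous_on_chart_inv:
  "is_chart c \<Longrightarrow> continuous_on (chart_map c ` chart_dom c) (chart_inv c)"
  unfolding is_chart_def homeomorphism_def by blast

lemma open_chart_image:
  assumes "is_chart c" "open S" "S \<subseteq> chart_dom c"
  shows "open (chart_map c ` S)"
proof -
  have "openin (top_of_set (chart_map c ` chart_dom c)) (chart_map c ` S)"
    using assms unfolding is_chart_def
    by (intro homeomorphism_imp_open_map[of "chart_dom c" _ _ "chart_inv c"])
      (auto simp: openin_open_eq)
  then show ?thesis
    using assms openin_open_eq unfolding is_chart_def by blast
qed

text \<open>
  Chain rule through an intermediate chart \<open>e\<close>. The two maps compared agree only where \<open>k\<close> takes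
  values in the domain of \<open>e\<close>, which is a neighbourhood since \<open>k\<close> is continuous.
\<close>

lemma has_derivative_in_charts_comp:
  fixes c e d :: "('a::metric_space, 'n::finite) chart"
  assumes c: "is_chart c" and e: "is_chart e"
    and p: "p \<in> chart_dom c" "k p \<in> chart_dom e"
    and k: "continuous_on UNIV k"
    and D1: "(in_charts c e k has_derivative D1) (at (chart_map c p))"
    and D2: "(in_charts e d g has_derivative D2) (at (chart_map e (k p)))"
  shows "(in_charts c d (g \<circ> k) has_derivative D2 \<circ> D1) (at (chart_map c p))"
proof -
  let ?S = "chart_dom c \<inter> k -` chart_dom e"
  have "open ?S"
    using c e k by (auto simp: is_chart_def intro: open_vimage)
  then have T: "open (chart_map c ` ?S)" "chart_map c p \<in> chart_map c ` ?S"
    using c p by (auto intro: open_chart_image)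
  have "in_charts c e k (chart_map c p) = chart_map e (k p)"
    using c p by (simp add: in_charts_def chart_inv_chart_map)
  then have "(in_charts e d g \<circ> in_charts c e k has_derivative D2 \<circ> D1) (at (chart_map c p))"
    using D1 D2 by (simp add: diff_chain_at)
  then show ?thesis
    by (rule has_derivative_transform_within_open[OF _ T])
      (auto simp: in_charts_def chart_inv_chart_map[OF c] chart_inv_chart_map[OF e])
qed

lemma C1_map_has_derivative:
  assumes "C1_map A g" "c \<in> A" "d \<in> A" "p \<in> chart_dom c" "g p \<in> chart_dom d" "is_chart c"
  shows "(in_charts c d g has_derivative frechet_derivative (in_charts c d g) (at (chart_map c p)))
           (at (chart_map c p))"
proof -
  have "C1_on (chart_map c ` (chart_dom c \<inter> g -` chart_dom d)) (in_charts c d g)"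
    using assms unfolding C1_map_def in_charts_def by blast
  moreover have "chart_map c p \<in> chart_map c ` (chart_dom c \<inter> g -` chart_dom d)"
    using assms by blast
  ultimately have "in_charts c d g differentiable at (chart_map c p)"
    unfolding C1_on_def differentiable_def by blast
  then show ?thesis
    by (simp add: frechet_derivative_works)
qed

section \<open>Volume forms in charts\<close>

definition form_coeff ::
  "('a, 'n::finite) chart set \<Rightarrow> ('a, 'n) top_form \<Rightarrow> ('a, 'n) chart \<Rightarrow> 'a \<Rightarrow> real" where
  "form_coeff A \<omega> c p = \<omega> p (\<lambda>i. coord_vector A c p (axis i 1))"

text \<open>
  Invariance of \<open>\<omega>\<close> in coordinates: the coefficient at the image times the Jacobian is the
  coefficient at the point. Unlike invariance of the form itself, this mentions no tangent
  vectors, so it passes to inverses and compositions by the chain rule for matrices.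
\<close>

definition preserves_coeff ::
  "('a, 'n::finite) chart set \<Rightarrow> ('a, 'n) top_form \<Rightarrow> ('a \<Rightarrow> 'a) \<Rightarrow> bool" where
  "preserves_coeff A \<omega> g \<longleftrightarrow>
     (\<forall>c\<in>A. \<forall>d\<in>A. \<forall>p\<in>chart_dom c. g p \<in> chart_dom d \<longrightarrow>
        (\<exists>L. (in_charts c d g has_derivative L) (at (chart_map c p)) \<and>
             form_coeff A \<omega> d (g p) * det (matrix L) = form_coeff A \<omega> c p))"

locale volume_manifold =
  fixes A :: "('a::metric_space, 'n::finite) chart set" and \<omega> :: "('a, 'n) top_form"
  assumes manifold: "C1_manifold A" and volume: "volume_form A \<omega>"
begin

lemma chart: "c \<in> A \<Longrightarrow> is_chart c"
  using manifold by (simp add: C1_manifold_def)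

lemma chart_at_ex: "\<exists>c. c \<in> charts_at A p"
proof -
  have "p \<in> (\<Union>c\<in>A. chart_dom c)"
    using manifold by (simp add: C1_manifold_def)
  then show ?thesis
    unfolding charts_at_def by blast
qed

lemma charts_atD:
  assumes "c \<in> charts_at A p"
  shows "c \<in> A" "p \<in> chart_dom c" "is_chart c"
  using assms chart by (auto simp: charts_at_def)

lemma C1_map_ident: "C1_map A (\<lambda>x. x)"
  using manifold by (auto simp: C1_map_def C1_manifold_def comp_def vimage_def)

lemma coord_vector_in_charts:
  assumes "d \<in> charts_at A p"
  shows "coord_vector A c p u d = frechet_derivative (in_charts c d (\<lambda>x. x)) (at (chart_map c p)) u"
  using assms by (simp add: coord_vector_def in_charts_id)

lemma frechet_derivative_in_charts_comp:
  assumes c: "c \<in> charts_at A p" and e: "e \<in> charts_at A (k p)" and d: "d \<in> charts_at A (g (k p))"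
    and k: "C1_map A k" and g: "C1_map A g"
  shows "frechet_derivative (in_charts c d (g \<circ> k)) (at (chart_map c p)) u =
    frechet_derivative (in_charts e d g) (at (chart_map e (k p)))
      (frechet_derivative (in_charts c e k) (at (chart_map c p)) u)"
proof -
  have "(in_charts c d (g \<circ> k) has_derivative
      frechet_derivative (in_charts e d g) (at (chart_map e (k p))) \<circ>
      frechet_derivative (in_charts c e k) (at (chart_map c p))) (at (chart_map c p))"
    using k by (intro has_derivative_in_charts_comp[where e = e] C1_map_has_derivative[OF k]
        C1_map_has_derivative[OF g] charts_atD[OF c] charts_atD[OF e] charts_atD[OF d])
      (simp add: C1_map_def)
  from frechet_derivative_at[OF this, symmetric] show ?thesis
    by simp
qed

lemma coord_vector_in_tangent_space:
  assumes c: "c \<in> charts_at A p"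
  shows "coord_vector A c p u \<in> tangent_space A p"
  unfolding tangent_space_def
proof (intro CollectI conjI ballI allI impI)
  fix e d assume e: "e \<in> charts_at A p" and d: "d \<in> charts_at A p"
  show "coord_vector A c p u d =
      frechet_derivative (chart_map d \<circ> chart_inv e) (at (chart_map e p)) (coord_vector A c p u e)"
    using frechet_derivative_in_charts_comp[of c p e "\<lambda>x. x" d "\<lambda>x. x" u] c d e
    by (simp add: coord_vector_in_charts C1_map_ident in_charts_id comp_def)
next
  fix d assume "d \<notin> charts_at A p"
  then show "coord_vector A c p u d = 0"
    by (simp add: coord_vector_def)
qed

lemma tangent_vector_eq_coord_vector:
  assumes "v \<in> tangent_space A p" "c \<in> charts_at A p"
  shows "v = coord_vector A c p (v c)"
proof
  note v = assms(1)[unfolded tangent_space_def mem_Collect_eq]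
  fix d
  show "v d = coord_vector A c p (v c) d"
  proof (cases "d \<in> charts_at A p")
    case True
    then have "v d = frechet_derivative (chart_map d \<circ> chart_inv c) (at (chart_map c p)) (v c)"
      by (rule v[THEN conjunct1, rule_format, OF assms(2)])
    with True show ?thesis
      by (simp only: coord_vector_def if_True)
  next
    case False
    then have "v d = 0"
      by (rule v[THEN conjunct2, rule_format])
    with False show ?thesis
      by (simp only: coord_vector_def if_False)
  qed
qed

lemma coord_vector_comb:
  assumes c: "c \<in> charts_at A p"
  shows "coord_vector A c p (a *\<^sub>R x + b *\<^sub>R y) =
    (\<lambda>d. a *\<^sub>R coord_vector A c p x d + b *\<^sub>R coord_vector A c p y d)"
proof
  fix d
  show "coord_vector A c p (a *\<^sub>R x + b *\<^sub>R y) d =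
    a *\<^sub>R coord_vector A c p x d + b *\<^sub>R coord_vector A c p y d"
  proof (cases "d \<in> charts_at A p")
    case True
    note lin = has_derivative_linear[OF C1_map_has_derivative[OF C1_map_ident charts_atD(1)[OF c]
          charts_atD(1)[OF True] charts_atD(2)[OF c] charts_atD(2)[OF True] charts_atD(3)[OF c]]]
    show ?thesis
      unfolding coord_vector_in_charts[OF True]
      by (simp only: linear_add[OF lin] linear_cmul[OF lin])
  qed (simp add: coord_vector_def)
qed

text \<open>
  Reading \<open>\<omega> p\<close> in a chart gives a form on coordinate vectors, which turns linear
  maps into determinants.
\<close>

lemma alternating_multilinear_form:
  assumes c: "c \<in> charts_at A p"
  shows "alternating_multilinear (\<lambda>v. \<omega> p (\<lambda>i. coord_vector A c p (v i)))"
proof -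
  have \<omega>: "alternating_multilinear_at A p (\<omega> p)"
    using volume by (auto simp: volume_form_def continuous_top_form_def)
  have T: "(\<lambda>i. coord_vector A c p (v i)) \<in> tangent_tuples A p" for v :: "'n \<Rightarrow> real^'n"
    using coord_vector_in_tangent_space[OF c] by (simp add: tangent_tuples_def)
  have upd: "(\<lambda>i. coord_vector A c p ((v(k := z)) i)) =
      (\<lambda>i. coord_vector A c p (v i))(k := coord_vector A c p z)" for v :: "'n \<Rightarrow> real^'n" and k z
    by auto
  have lin: "\<omega> p (v(i := (\<lambda>c. a *\<^sub>R x c + b *\<^sub>R y c))) = a * \<omega> p (v(i := x)) + b * \<omega> p (v(i := y))"
    if "v \<in> tangent_tuples A p" "x \<in> tangent_space A p" "y \<in> tangent_space A p" for v i x y a b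
    by (rule \<omega>[unfolded alternating_multilinear_at_def, THEN conjunct1, rule_format, OF that])
  show ?thesis
    unfolding alternating_multilinear_def
  proof (intro conjI allI impI)
    fix v :: "'n \<Rightarrow> real^'n" and i x y and a b :: real
    show "\<omega> p (\<lambda>j. coord_vector A c p ((v(i := a *\<^sub>R x + b *\<^sub>R y)) j)) =
        a * \<omega> p (\<lambda>j. coord_vector A c p ((v(i := x)) j)) +
        b * \<omega> p (\<lambda>j. coord_vector A c p ((v(i := y)) j))"
      unfolding upd coord_vector_comb[OF c]
      by (intro lin T coord_vector_in_tangent_space[OF c])
  next
    fix v :: "'n \<Rightarrow> real^'n" and i j
    assume "i \<noteq> j \<and> v i = v j"
    then have "i \<noteq> j \<and> coord_vector A c p (v i) = coord_vector A c p (v j)"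
      by simp
    then show "\<omega> p (\<lambda>k. coord_vector A c p (v k)) = 0"
      by (rule \<omega>[unfolded alternating_multilinear_at_def, THEN conjunct2, rule_format, OF T])
  qed
qed

lemma form_coeff_linear:
  assumes "c \<in> charts_at A p"
  shows "\<omega> p (\<lambda>i. coord_vector A c p (L (axis i 1))) = det (matrix L) * form_coeff A \<omega> c p"
  using alternating_multilinear_linear_image[OF alternating_multilinear_form[OF assms]]
  by (simp add: form_coeff_def)

text \<open>
  A tuple on which \<open>\<omega> p\<close> does not vanish is the image of the coordinate frame under a linear
  map, so \<open>\<omega> p\<close> cannot vanish on the coordinate frame.
\<close>

lemma form_coeff_nonzero:
  assumes c: "c \<in> charts_at A p"
  shows "form_coeff A \<omega> c p \<noteq> 0"
proof -
  obtain v where v: "v \<in> tangent_tuples A p" "\<omega> p v \<noteq> 0"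
    using volume unfolding volume_form_def by blast
  define M :: "real^'n^'n" where "M = (\<chi> i. v i c)"
  have v_in: "v i \<in> tangent_space A p" for i
    using v(1) by (simp add: tangent_tuples_def)
  have eq: "v = (\<lambda>i. coord_vector A c p (transpose M *v axis i 1))"
  proof
    fix i
    have *: "transpose M *v axis i 1 = v i c"
      by (simp add: matrix_vector_mult_basis M_def row_def)
    show "v i = coord_vector A c p (transpose M *v axis i 1)"
      unfolding * by (rule tangent_vector_eq_coord_vector[OF v_in c])
  qed
  show ?thesis
  proof
    assume "form_coeff A \<omega> c p = 0"
    then have "\<omega> p (\<lambda>i. coord_vector A c p (transpose M *v axis i 1)) = 0"
      by (simp only: form_coeff_linear[OF c, of "(*v) (transpose M)"] mult_zero_right)
    then show False
      using v(2) by (simp only: eq[symmetric])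
  qed
qed

lemma continuous_on_form_coeff:
  "c \<in> A \<Longrightarrow> continuous_on (chart_dom c) (form_coeff A \<omega> c)"
  using volume unfolding volume_form_def continuous_top_form_def form_coeff_def[abs_def] by blast

text \<open>
  The differential is defined through an arbitrary chart \<open>b\<close> around \<open>p\<close>. The chain rule
  eliminates \<open>b\<close>.
\<close>

lemma differential_coord_vector:
  assumes c: "c \<in> charts_at A p" and d: "d \<in> charts_at A (f p)" and f: "C1_map A f"
  shows "differential A f p (coord_vector A c p u) =
    coord_vector A d (f p) (frechet_derivative (in_charts c d f) (at (chart_map c p)) u)"
proof
  fix d'
  show "differential A f p (coord_vector A c p u) d' =
    coord_vector A d (f p) (frechet_derivative (in_charts c d f) (at (chart_map c p)) u) d'"
  proof (cases "d' \<in> charts_at A (f p)")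
    case True
    define b where "b = (SOME b. b \<in> charts_at A p)"
    have b: "b \<in> charts_at A p"
      using c unfolding b_def by (rule someI)
    have "differential A f p (coord_vector A c p u) d' =
        frechet_derivative (in_charts b d' f) (at (chart_map b p)) (coord_vector A c p u b)"
      using True by (simp add: differential_def b_def[symmetric] in_charts_def)
    also have "\<dots> = frechet_derivative (in_charts c d' f) (at (chart_map c p)) u"
      using frechet_derivative_in_charts_comp[of c p b "\<lambda>x. x" d' f u] b c True f
      by (simp add: coord_vector_in_charts C1_map_ident comp_def)
    also have "\<dots> = coord_vector A d (f p) (frechet_derivative (in_charts c d f) (at (chart_map c p)) u) d'"
      using frechet_derivative_in_charts_comp[of c p d f d' "\<lambda>x. x" u] d c True f
      by (simp add: coord_vector_in_charts C1_map_ident comp_def)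
    finally show ?thesis .
  qed (simp add: differential_def coord_vector_def)
qed

lemma preserves_coeff_if_preserves_form:
  assumes f: "C1_map A f" and pres: "preserves_form A f \<omega>"
  shows "preserves_coeff A \<omega> f"
  unfolding preserves_coeff_def
proof (intro ballI impI)
  fix c d p
  assume c: "c \<in> A" "p \<in> chart_dom c" and d: "d \<in> A" "f p \<in> chart_dom d"
  then have c': "c \<in> charts_at A p" and d': "d \<in> charts_at A (f p)"
    by (auto simp: charts_at_def)
  let ?L = "frechet_derivative (in_charts c d f) (at (chart_map c p))"
  have "form_coeff A \<omega> c p = pullback A f \<omega> p (\<lambda>i. coord_vector A c p (axis i 1))"
    using pres coord_vector_in_tangent_space[OF c']
    by (simp add: form_coeff_def preserves_form_def tangent_tuples_def)
  also have "\<dots> = \<omega> (f p) (\<lambda>i. coord_vector A d (f p) (?L (axis i 1)))"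
    by (simp add: pullback_def differential_coord_vector[OF c' d' f])
  also have "\<dots> = form_coeff A \<omega> d (f p) * det (matrix ?L)"
    by (simp add: form_coeff_linear[OF d'])
  finally show "\<exists>L. (in_charts c d f has_derivative L) (at (chart_map c p)) \<and>
      form_coeff A \<omega> d (f p) * det (matrix L) = form_coeff A \<omega> c p"
    using C1_map_has_derivative[OF f c(1) d(1) c(2) d(2) chart[OF c(1)]] by auto
qed

lemma preserves_coeff_inverse:
  assumes f: "preserves_coeff A \<omega> f" and g: "C1_map A g" and fg: "\<And>x. f (g x) = x"
  shows "preserves_coeff A \<omega> g"
  unfolding preserves_coeff_def
proof (intro ballI impI)
  fix c d p
  assume c: "c \<in> A" "p \<in> chart_dom c" and d: "d \<in> A" "g p \<in> chart_dom d"
  let ?L = "frechet_derivative (in_charts c d g) (at (chart_map c p))"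
  note L = C1_map_has_derivative[OF g c(1) d(1) c(2) d(2) chart[OF c(1)]]
  obtain K where K: "(in_charts d c f has_derivative K) (at (chart_map d (g p)))"
      "form_coeff A \<omega> c p * det (matrix K) = form_coeff A \<omega> d (g p)"
    using f c d fg[of p] unfolding preserves_coeff_def by metis
  have "(in_charts c c (f \<circ> g) has_derivative K \<circ> ?L) (at (chart_map c p))"
    using c d g K L by (intro has_derivative_in_charts_comp[where e = d] chart)
      (auto simp: C1_map_def)
  then have "((\<lambda>x. x) has_derivative K \<circ> ?L) (at (chart_map c p))"
  proof (rule has_derivative_transform_within_open)
    show "open (chart_map c ` chart_dom c)"
      using chart[OF c(1)] by (simp add: is_chart_def)
  qed (use c in \<open>auto simp: in_charts_def fg chart_inv_chart_map[OF chart[OF c(1)]]\<close>)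
  then have "K \<circ> ?L = id"
    using has_derivative_unique has_derivative_ident unfolding id_def by blast
  then have "matrix K ** matrix ?L = mat 1"
    using matrix_compose[OF has_derivative_linear[OF L] has_derivative_linear[OF K(1)]]
    by (simp add: matrix_id_mat_1)
  then have "det (matrix K) * det (matrix ?L) = 1"
    by (metis det_I det_mul)
  then have "form_coeff A \<omega> d (g p) * det (matrix ?L) = form_coeff A \<omega> c p"
    by (simp add: det_mul K(2)[symmetric])
  then show "\<exists>L. (in_charts c d g has_derivative L) (at (chart_map c p)) \<and>
      form_coeff A \<omega> d (g p) * det (matrix L) = form_coeff A \<omega> c p"
    using L by blast
qed

lemma preserves_coeff_comp:
  assumes g: "preserves_coeff A \<omega> g" and k: "preserves_coeff A \<omega> k" and cont: "continuous_on UNIV k"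
  shows "preserves_coeff A \<omega> (g \<circ> k)"
  unfolding preserves_coeff_def
proof (intro ballI impI)
  fix c d p
  assume c: "c \<in> A" "p \<in> chart_dom c" and d: "d \<in> A" "(g \<circ> k) p \<in> chart_dom d"
  obtain e where e: "e \<in> A" "k p \<in> chart_dom e"
    using chart_at_ex[of "k p"] by (auto simp: charts_at_def)
  obtain L where L: "(in_charts c e k has_derivative L) (at (chart_map c p))"
      "form_coeff A \<omega> e (k p) * det (matrix L) = form_coeff A \<omega> c p"
    using k c e unfolding preserves_coeff_def by blast
  obtain K where K: "(in_charts e d g has_derivative K) (at (chart_map e (k p)))"
      "form_coeff A \<omega> d (g (k p)) * det (matrix K) = form_coeff A \<omega> e (k p)"
    using g d e unfolding preserves_coeff_def comp_def by blast
  have "(in_charts c d (g \<circ> k) has_derivative K \<circ> L) (at (chart_map c p))"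
    using c e cont L K by (intro has_derivative_in_charts_comp[where e = e] chart) auto
  moreover have "det (matrix (K \<circ> L)) = det (matrix K) * det (matrix L)"
    using matrix_compose[of L K] K(1) L(1) has_derivative_linear by (metis det_mul)
  ultimately show "\<exists>L. (in_charts c d (g \<circ> k) has_derivative L) (at (chart_map c p)) \<and>
      form_coeff A \<omega> d ((g \<circ> k) p) * det (matrix L) = form_coeff A \<omega> c p"
    using K(2) L(2) by (intro exI[of _ "K \<circ> L"]) (simp add: mult.assoc[symmetric])
qed

lemma preserves_coeff_funpow:
  assumes "preserves_coeff A \<omega> g" "continuous_on UNIV g" "k > 0"
  shows "preserves_coeff A \<omega> (g ^^ k)"
  using \<open>k > 0\<close>
proof (induction k rule: nat_induct_non_zero)
  case (Suc k)
  then show ?case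
    using preserves_coeff_comp[OF Suc.IH assms(1,2)] by (simp only: funpow_Suc_right)
qed (use assms in simp)

text \<open>
  Invariance makes the Jacobian of \<open>G\<close> in charts a quotient of two nonvanishing continuous
  coefficients. It is therefore continuous on \<open>S\<close>, and \<open>b\<close> bounds it. For iterates this spares
  an induction over the continuity of their derivatives.
\<close>

lemma measure_chart_image_le:
  assumes G: "preserves_coeff A \<omega> G" and contG: "continuous_on UNIV G"
    and c: "c \<in> A" and d: "d \<in> A"
    and S: "compact S" "S \<subseteq> chart_dom c" "G ` S \<subseteq> chart_dom d"
    and le: "\<And>q. q \<in> S \<Longrightarrow> \<bar>form_coeff A \<omega> c q\<bar> \<le> b * \<bar>form_coeff A \<omega> d (G q)\<bar>"
  shows "measure lebesgue (chart_map d ` G ` S) \<le> b * measure lebesgue (chart_map c ` S)"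
proof -
  have inv: "chart_inv c (chart_map c q) = q" if "q \<in> S" for q
    using that S chart[OF c] chart_inv_chart_map by blast
  have "\<exists>L. (in_charts c d G has_derivative L) (at (chart_map c q)) \<and>
      form_coeff A \<omega> d (G q) * det (matrix L) = form_coeff A \<omega> c q" if "q \<in> S" for q
    using that G c d S unfolding preserves_coeff_def by blast
  then obtain L where L: "\<And>q. q \<in> S \<Longrightarrow> (in_charts c d G has_derivative L q) (at (chart_map c q))"
    "\<And>q. q \<in> S \<Longrightarrow> form_coeff A \<omega> d (G q) * det (matrix (L q)) = form_coeff A \<omega> c q"
    by metis
  have nz: "form_coeff A \<omega> d (G q) \<noteq> 0" if "q \<in> S" for q
    using that S d by (intro form_coeff_nonzero) (auto simp: charts_at_def)
  have det: "\<bar>det (matrix (L q))\<bar> = \<bar>form_coeff A \<omega> c q\<bar> / \<bar>form_coeff A \<omega> d (G q)\<bar>" if "q \<in> S" for q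
    using L(2)[OF that] nz[OF that] by (simp add: field_simps flip: abs_mult)
  have "measure lebesgue (in_charts c d G ` chart_map c ` S) \<le> b * measure lebesgue (chart_map c ` S)"
  proof (rule measure_differentiable_image_le)
    have sub: "chart_map c ` S \<subseteq> chart_map c ` chart_dom c"
      using S by blast
    have cont_inv: "continuous_on (chart_map c ` S) (chart_inv c)"
      using continuous_on_chart_inv[OF chart[OF c]] sub by (rule continuous_on_subset)
    show "compact (chart_map c ` S)"
      by (rule compact_continuous_image[OF continuous_on_subset[OF continuous_on_chart_map[OF chart[OF c]] S(2)] S(1)])
    show "(in_charts c d G has_derivative L (chart_inv c x)) (at x within chart_map c ` S)"
      if "x \<in> chart_map c ` S" for x
      using that L(1) inv by (auto intro: has_derivative_at_withinI)
    have "continuous_on S (\<lambda>q. \<bar>form_coeff A \<omega> c q\<bar> / \<bar>form_coeff A \<omega> d (G q)\<bar>)"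
    proof (intro continuous_on_divide continuous_on_rabs)
      show "continuous_on S (form_coeff A \<omega> c)"
        by (rule continuous_on_subset[OF continuous_on_form_coeff[OF c] S(2)])
      show "continuous_on S (\<lambda>q. form_coeff A \<omega> d (G q))"
        by (rule continuous_on_compose2[OF continuous_on_form_coeff[OF d] continuous_on_subset[OF contG]])
          (use S(3) in auto)
    qed (simp add: nz)
    then have "continuous_on S (\<lambda>q. \<bar>det (matrix (L q))\<bar>)"
      by (rule continuous_on_eq) (simp add: det)
    then show "continuous_on (chart_map c ` S) (\<lambda>x. \<bar>det (matrix (L (chart_inv c x)))\<bar>)"
      by (rule continuous_on_compose2[OF _ cont_inv]) (auto simp: inv)
    show "\<bar>det (matrix (L (chart_inv c x)))\<bar> \<le> b" if "x \<in> chart_map c ` S" for x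
      using that le nz by (auto simp: inv det divide_le_eq)
  qed
  also have "in_charts c d G ` chart_map c ` S = chart_map d ` G ` S"
    by (force simp: in_charts_def inv)
  finally show ?thesis .
qed

end

section \<open>Recurrence\<close>

text \<open>
  A return time of at least \<open>2\<close> keeps the two jumps, from \<open>f p\<close> to \<open>f q\<close> and from
  \<open>(f ^^ k) q\<close> to \<open>p\<close>, in different steps of the chain.
\<close>

lemma strongly_chain_recurrent_if_returns:
  fixes f :: "'a::metric_space \<Rightarrow> 'a"
  assumes f: "continuous_on UNIV f"
    and returns: "\<And>U. open U \<Longrightarrow> p \<in> U \<Longrightarrow> \<exists>k\<ge>2. \<exists>q\<in>U. (f ^^ k) q \<in> U"
  shows "strongly_chain_recurrent f p"
  unfolding strongly_chain_recurrent_def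
proof (intro allI impI)
  fix \<epsilon> :: "'a \<Rightarrow> real"
  assume \<epsilon>: "continuous_on UNIV \<epsilon> \<and> (\<forall>x. 0 < \<epsilon> x)"
  define U where "U = {y. dist (f p) (f y) < \<epsilon> (f p)} \<inter> {y. dist y p < \<epsilon> y}"
  have "open U"
    unfolding U_def using f \<epsilon> by (intro open_Int open_Collect_less continuous_intros) auto
  moreover have "p \<in> U"
    using \<epsilon> by (simp add: U_def)
  ultimately obtain k q where k: "k \<ge> 2" and q: "q \<in> U" "(f ^^ k) q \<in> U"
    using returns by blast
  define x where "x j = (if j = 0 \<or> j = k then p else (f ^^ j) q)" for j
  have "dist (f (x j)) (x (Suc j)) < \<epsilon> (f (x j))" if "j < k" for j
  proof -
    consider "j = 0" | "0 < j" "Suc j < k" | "0 < j" "Suc j = k"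
      using \<open>j < k\<close> by linarith
    then show ?thesis
    proof cases
      case 1
      then show ?thesis
        using k q by (simp add: x_def U_def)
    next
      case 2
      then show ?thesis
        using \<epsilon> by (simp add: x_def)
    next
      case 3
      then have "f (x j) = (f ^^ k) q" "x (Suc j) = p"
        by (auto simp: x_def)
      then show ?thesis
        using q by (simp add: U_def)
    qed
  qed
  then have "eps_chain f \<epsilon> k x"
    unfolding eps_chain_def by blast
  moreover have "x 0 = p" "x k = p" "k \<ge> 1"
    using k by (simp_all add: x_def)
  ultimately show "\<exists>n\<ge>1. \<exists>x. eps_chain f \<epsilon> n x \<and> x 0 = p \<and> x n = p"
    by blast
qed

lemma continuous_on_funpow:
  fixes f :: "'a::topological_space \<Rightarrow> 'a"
  assumes "continuous_on UNIV f"
  shows "continuous_on UNIV (f ^^ k)"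
proof (induction k)
  case (Suc k)
  then show ?case
    using assms continuous_on_compose2[of UNIV f UNIV "f ^^ k"] by (simp add: comp_def)
qed (simp add: id_def)

lemma funpow_inverse:
  fixes f g :: "'a \<Rightarrow> 'a"
  assumes "\<And>x. g (f x) = x"
  shows "(g ^^ k) ((f ^^ k) x) = x"
proof (induction k arbitrary: x)
  case (Suc k)
  have "(g ^^ Suc k) ((f ^^ Suc k) x) = (g ^^ k) (g (f ((f ^^ k) x)))"
    using funpow_Suc_right[of k g] by simp
  then show ?case
    by (simp only: assms Suc)
qed simp

context volume_manifold
begin

lemma compact_neighbourhood_in_chart:
  assumes W: "open W" "p \<in> W"
  obtains c C r where "c \<in> A" "compact C" "C \<subseteq> chart_dom c \<inter> W" "r > 0" "ball p r \<subseteq> C"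
proof -
  obtain c where c: "c \<in> A" "p \<in> chart_dom c" "is_chart c"
    using chart_at_ex[of p] charts_atD by blast
  have "open (chart_map c ` (chart_dom c \<inter> W))"
    using c W by (intro open_chart_image) (auto simp: is_chart_def)
  then obtain s where s: "s > 0" "cball (chart_map c p) s \<subseteq> chart_map c ` (chart_dom c \<inter> W)"
    using c W open_contains_cball by (metis IntI imageI)
  define C where "C = chart_inv c ` cball (chart_map c p) s"
  have "continuous_on (cball (chart_map c p) s) (chart_inv c)"
    using s by (intro continuous_on_subset[OF continuous_on_chart_inv[OF c(3)]]) blast
  then have "compact C"
    unfolding C_def by (intro compact_continuous_image) auto
  have C_sub: "C \<subseteq> chart_dom c \<inter> W"
  proof
    fix y assume "y \<in> C"
    then obtain x where "x \<in> cball (chart_map c p) s" "y = chart_inv c x"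
      by (auto simp: C_def)
    moreover from this s obtain z where "z \<in> chart_dom c \<inter> W" "x = chart_map c z"
      by blast
    ultimately show "y \<in> chart_dom c \<inter> W"
      using chart_inv_chart_map[OF c(3)] by simp
  qed
  obtain r where r: "r > 0" "ball p r \<subseteq> C"
  proof -
    have "open (chart_dom c \<inter> chart_map c -` ball (chart_map c p) s)"
      using c by (intro continuous_open_preimage continuous_on_chart_map) (auto simp: is_chart_def)
    moreover have "p \<in> chart_dom c \<inter> chart_map c -` ball (chart_map c p) s"
      using c s by simp
    ultimately obtain r where r: "r > 0"
        "ball p r \<subseteq> chart_dom c \<inter> chart_map c -` ball (chart_map c p) s"
      using open_contains_ball by blast
    have "y \<in> C" if "y \<in> ball p r" for y
    proof -
      have "y \<in> chart_dom c" "chart_map c y \<in> cball (chart_map c p) s"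
        using that r by auto
      then show ?thesis
        unfolding C_def using chart_inv_chart_map[OF c(3)] by (metis image_eqI)
    qed
    then show thesis
      using that[OF r(1)] by blast
  qed
  show thesis
    by (rule that[OF c(1) \<open>compact C\<close> C_sub r])
qed

text \<open>
  The manifold need not be second countable, but the union of the orbits of a compact subset of
  a chart is separable. Balls of radius \<open>1 / (m + 1)\<close> around the points of a countable dense
  subset, as far as they fit into a compact subset of a chart, cover its closure.
\<close>

lemma countable_cover_of_orbit_closures:
  assumes f: "continuous_on UNIV f" and c: "c \<in> A" and C: "compact C" "C \<subseteq> chart_dom c"
  obtains \<U> where "countable \<U>"
    "\<And>B. B \<in> \<U> \<Longrightarrow> open B \<and> (\<exists>d\<in>A. \<exists>K. compact K \<and> B \<subseteq> K \<and> K \<subseteq> chart_dom d)"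
    "\<And>q. q \<in> C \<Longrightarrow> closure {(f ^^ k) q |k. k \<ge> 0} \<subseteq> \<Union>\<U>"
proof -
  obtain T where T: "countable T" "T \<subseteq> chart_map c ` C" "chart_map c ` C \<subseteq> closure T"
    by (rule separable)
  define D where "D = (\<Union>k. (f ^^ k) ` chart_inv c ` T)"
  have "countable D"
    unfolding D_def by (intro countable_UN countable_image countableI_type T(1))
  have orbit: "(f ^^ k) q \<in> closure D" if "q \<in> C" for q k
  proof -
    have "compact (chart_map c ` C)"
      by (rule compact_continuous_image[OF continuous_on_subset[OF
            continuous_on_chart_map[OF chart[OF c]] C(2)] C(1)])
    then have "closure T \<subseteq> chart_map c ` C"
      using T by (simp add: closure_minimal compact_imp_closed)
    then have "closure T \<subseteq> chart_map c ` chart_dom c"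
      using C by blast
    then have "continuous_on (closure T) (chart_inv c)"
      by (rule continuous_on_subset[OF continuous_on_chart_inv[OF chart[OF c]]])
    then have "continuous_on (closure T) (\<lambda>x. (f ^^ k) (chart_inv c x))"
      by (rule continuous_on_compose2[OF continuous_on_funpow[OF f]]) simp
    moreover have "(\<lambda>x. (f ^^ k) (chart_inv c x)) ` T \<subseteq> closure D"
    proof (rule order_trans[OF _ closure_subset])
      show "(\<lambda>x. (f ^^ k) (chart_inv c x)) ` T \<subseteq> D"
        unfolding D_def by blast
    qed
    ultimately have "(\<lambda>x. (f ^^ k) (chart_inv c x)) ` closure T \<subseteq> closure D"
      by (intro image_closure_subset) auto
    moreover have "chart_map c q \<in> closure T" "chart_inv c (chart_map c q) = q"
      using that T C chart_inv_chart_map[OF chart[OF c]] by auto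
    ultimately show ?thesis
      by force
  qed
  define small where "small B \<longleftrightarrow> (\<exists>d\<in>A. \<exists>K. compact K \<and> B \<subseteq> K \<and> K \<subseteq> chart_dom d)" for B :: "'a set"
  define \<U> where "\<U> = {B \<in> (\<lambda>(x, m). ball x (1 / real (Suc m))) ` (D \<times> UNIV). small B}"
  have "countable \<U>"
    unfolding \<U>_def using \<open>countable D\<close>
    by (intro countable_subset[OF Collect_subset] countable_image countable_SIGMA countableI_type)
  have open_small: "open B \<and> (\<exists>d\<in>A. \<exists>K. compact K \<and> B \<subseteq> K \<and> K \<subseteq> chart_dom d)" if "B \<in> \<U>" for B
  proof
    show "open B"
      using that by (auto simp: \<U>_def)
    have "small B"
      using that by (simp add: \<U>_def)
    then show "\<exists>d\<in>A. \<exists>K. compact K \<and> B \<subseteq> K \<and> K \<subseteq> chart_dom d"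
      unfolding small_def .
  qed
  have cover: "closure D \<subseteq> \<Union>\<U>"
  proof
    fix x assume x: "x \<in> closure D"
    obtain d K r where K: "d \<in> A" "compact K" "K \<subseteq> chart_dom d" "r > 0" "ball x r \<subseteq> K"
      using compact_neighbourhood_in_chart[of UNIV x] by (metis Int_UNIV_right UNIV_I open_UNIV)
    obtain m where m: "1 / real (Suc m) < r / 2"
      using \<open>r > 0\<close> nat_approx_posE[of "r / 2"] by auto
    obtain y where y: "y \<in> D" "dist y x < 1 / real (Suc m)"
      using x closure_approachable by (metis of_nat_0_less_iff zero_less_Suc zero_less_divide_1_iff)
    have "ball y (1 / real (Suc m)) \<subseteq> ball x r"
    proof
      fix z assume "z \<in> ball y (1 / real (Suc m))"
      then have "dist y z < r / 2" "dist y x < r / 2"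
        using m y by auto
      then show "z \<in> ball x r"
        using dist_triangle3[of x z y] by simp
    qed
    then have "small (ball y (1 / real (Suc m)))"
      unfolding small_def using K by (meson order_trans)
    moreover have "ball y (1 / real (Suc m)) \<in> (\<lambda>(x, m). ball x (1 / real (Suc m))) ` (D \<times> UNIV)"
      using y(1) by (intro image_eqI[of _ _ "(y, m)"]) simp_all
    ultimately have "ball y (1 / real (Suc m)) \<in> \<U>"
      unfolding \<U>_def by blast
    moreover have "x \<in> ball y (1 / real (Suc m))"
      using y by simp
    ultimately show "x \<in> \<Union>\<U>"
      by blast
  qed
  show thesis
  proof (rule that[OF \<open>countable \<U>\<close> open_small])
    fix q assume "q \<in> C"
    then have "{(f ^^ k) q |k. k \<ge> 0} \<subseteq> closure D"
      using orbit by blast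
    then show "closure {(f ^^ k) q |k. k \<ge> 0} \<subseteq> \<Union>\<U>"
      by (rule order_trans[OF closure_minimal[OF _ closed_closure] cover])
  qed
qed

text \<open>
  Supplies the distortion factor for maps from \<open>K\<close> to \<open>C\<close>; it depends on the two compact sets
  and not on the map.
\<close>

lemma form_coeff_ratio_bounded:
  assumes c: "c \<in> A" "compact C" "C \<subseteq> chart_dom c" and d: "d \<in> A" "compact K" "K \<subseteq> chart_dom d"
  obtains b where "b \<ge> 0"
    "\<And>x y. x \<in> K \<Longrightarrow> y \<in> C \<Longrightarrow> \<bar>form_coeff A \<omega> d x\<bar> \<le> b * \<bar>form_coeff A \<omega> c y\<bar>"
proof (cases "C = {} \<or> K = {}")
  case True
  then show thesis
    using that[of 0] by auto
next
  case False
  have "continuous_on C (\<lambda>y. \<bar>form_coeff A \<omega> c y\<bar>)"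
    by (intro continuous_on_rabs continuous_on_subset[OF continuous_on_form_coeff] c)
  then obtain y0 where y0: "y0 \<in> C" "\<And>y. y \<in> C \<Longrightarrow> \<bar>form_coeff A \<omega> c y0\<bar> \<le> \<bar>form_coeff A \<omega> c y\<bar>"
    using continuous_attains_inf[OF c(2)] False by blast
  have "continuous_on K (\<lambda>x. \<bar>form_coeff A \<omega> d x\<bar>)"
    by (intro continuous_on_rabs continuous_on_subset[OF continuous_on_form_coeff] d)
  then obtain x0 where x0: "x0 \<in> K" "\<And>x. x \<in> K \<Longrightarrow> \<bar>form_coeff A \<omega> d x\<bar> \<le> \<bar>form_coeff A \<omega> d x0\<bar>"
    using continuous_attains_sup[OF d(2)] False by blast
  have nz: "form_coeff A \<omega> c y0 \<noteq> 0"
    using y0 c by (intro form_coeff_nonzero) (auto simp: charts_at_def)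
  let ?b = "\<bar>form_coeff A \<omega> d x0\<bar> / \<bar>form_coeff A \<omega> c y0\<bar>"
  have "\<bar>form_coeff A \<omega> d x\<bar> \<le> ?b * \<bar>form_coeff A \<omega> c y\<bar>" if "x \<in> K" "y \<in> C" for x y
  proof -
    have "\<bar>form_coeff A \<omega> d x\<bar> \<le> ?b * \<bar>form_coeff A \<omega> c y0\<bar>"
      using x0(2)[OF \<open>x \<in> K\<close>] nz by simp
    also have "\<dots> \<le> ?b * \<bar>form_coeff A \<omega> c y\<bar>"
      using y0(2)[OF \<open>y \<in> C\<close>] by (intro mult_left_mono) auto
    finally show ?thesis .
  qed
  then show thesis
    using that[of ?b] by simp
qed

lemma compact_chart_image:
  "c \<in> A \<Longrightarrow> compact S \<Longrightarrow> S \<subseteq> chart_dom c \<Longrightarrow> compact (chart_map c ` S)"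
  by (rule compact_continuous_image[OF continuous_on_subset[OF continuous_on_chart_map[OF chart]]])

lemma inj_on_chart_map: "c \<in> A \<Longrightarrow> inj_on (chart_map c) (chart_dom c)"
  by (rule inj_on_inverseI[of _ "chart_inv c"]) (rule chart_inv_chart_map[OF chart])

text \<open>
  The points of a compact neighbourhood of \<open>p\<close> are sorted by a finite subfamily of the countable
  cover that contains their whole orbit. Countably many negligible sets cannot cover a set with
  nonempty interior.
\<close>

lemma bounded_orbits_of_positive_volume:
  assumes f: "continuous_on UNIV f" and stable: "Lagrange_stable f" and W: "open W" "p \<in> W"
  obtains c E F ch K where "c \<in> A" "compact E" "E \<subseteq> chart_dom c \<inter> W"
    "measure lebesgue (chart_map c ` E) > 0" "finite F"
    "\<And>B. B \<in> F \<Longrightarrow> ch B \<in> A \<and> compact (K B) \<and> K B \<subseteq> chart_dom (ch B)"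
    "\<And>q k. q \<in> E \<Longrightarrow> (f ^^ k) q \<in> (\<Union>B\<in>F. K (B :: 'a set))"
proof -
  obtain c C r where C: "c \<in> A" "compact C" "C \<subseteq> chart_dom c \<inter> W" "r > 0" "ball p r \<subseteq> C"
    using compact_neighbourhood_in_chart[OF W] .
  obtain \<U> where \<U>: "countable \<U>"
    "\<And>B. B \<in> \<U> \<Longrightarrow> open B \<and> (\<exists>d\<in>A. \<exists>K. compact K \<and> B \<subseteq> K \<and> K \<subseteq> chart_dom d)"
    "\<And>q. q \<in> C \<Longrightarrow> closure {(f ^^ k) q |k. k \<ge> 0} \<subseteq> \<Union>\<U>"
    using countable_cover_of_orbit_closures[OF f C(1,2)] C(3) by blast
  obtain ch K where K:
    "\<And>B. B \<in> \<U> \<Longrightarrow> ch B \<in> A \<and> compact (K B) \<and> B \<subseteq> K B \<and> K B \<subseteq> chart_dom (ch B)"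
    using \<U>(2) by metis
  define E where "E F = C \<inter> (\<Inter>k. (f ^^ k) -` (\<Union>B\<in>F. K B))" for F
  let ?\<F> = "{F. finite F \<and> F \<subseteq> \<U>}"
  have E: "compact (E F)" if "F \<in> ?\<F>" for F
  proof -
    have "closed (\<Union>B\<in>F. K B)"
      using that K by (intro closed_UN compact_imp_closed) auto
    then have "closed ((f ^^ k) -` (\<Union>B\<in>F. K B))" for k
      using continuous_on_funpow[OF f] by (rule closed_vimage)
    then show ?thesis
      unfolding E_def using C by (intro compact_Int_closed) auto
  qed
  have cover: "C \<subseteq> (\<Union>F\<in>?\<F>. E F)"
  proof
    fix q assume q: "q \<in> C"
    have "compact (closure {(f ^^ k) q |k. k \<ge> 0})"
      using stable unfolding Lagrange_stable_def by blast
    then show "q \<in> (\<Union>F\<in>?\<F>. E F)"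
    proof (rule compactE[OF _ \<U>(3)[OF q]])
      show "open B" if "B \<in> \<U>" for B
        using \<U>(2)[OF that] by (rule conjunct1)
      fix F assume F: "F \<subseteq> \<U>" "finite F" "closure {(f ^^ k) q |k. k \<ge> 0} \<subseteq> \<Union>F"
      have "(f ^^ k) q \<in> (\<Union>B\<in>F. K B)" for k
      proof -
        have "(f ^^ k) q \<in> \<Union>F"
          using F(3) closure_subset[of "{(f ^^ k) q |k. k \<ge> 0}"] by blast
        then show ?thesis
          using F(1) K by blast
      qed
      then have "q \<in> E F"
        using q by (simp add: E_def)
      then show "q \<in> (\<Union>F\<in>?\<F>. E F)"
        using F(1,2) by blast
    qed
  qed
  have "\<exists>F\<in>?\<F>. \<not> negligible (chart_map c ` E F)"
  proof (rule ccontr)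
    assume "\<not> ?thesis"
    then have null: "negligible (chart_map c ` E F)" if "F \<in> ?\<F>" for F
      using that by blast
    have "negligible (\<Union>F\<in>?\<F>. chart_map c ` E F)"
    proof (rule negligible_countable_Union)
      show "countable ((\<lambda>F. chart_map c ` E F) ` ?\<F>)"
        by (intro countable_image countable_Collect_finite_subset \<U>(1))
      show "negligible T" if "T \<in> (\<lambda>F. chart_map c ` E F) ` ?\<F>" for T
        using that null by (elim imageE) (simp only:)
    qed
    moreover have "chart_map c ` ball p r \<subseteq> (\<Union>F\<in>?\<F>. chart_map c ` E F)"
      using image_mono[OF order_trans[OF C(5) cover], of "chart_map c"] by (simp only: image_UN)
    ultimately have "negligible (chart_map c ` ball p r)"
      by (rule negligible_subset)
    moreover have "open (chart_map c ` ball p r)"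
      using C chart[OF C(1)] by (intro open_chart_image) auto
    moreover have "chart_map c ` ball p r \<noteq> {}"
      using C by simp
    ultimately show False
      using open_not_negligible by blast
  qed
  then obtain F where F: "finite F" "F \<subseteq> \<U>" "\<not> negligible (chart_map c ` E F)"
    by blast
  have EF: "compact (E F)" "E F \<subseteq> chart_dom c \<inter> W"
  proof -
    show "compact (E F)"
      using E F(1,2) by simp
    show "E F \<subseteq> chart_dom c \<inter> W"
      using C(3) unfolding E_def by blast
  qed
  have "chart_map c ` E F \<in> lmeasurable"
    using EF C(1) by (intro lmeasurable_compact compact_chart_image) auto
  then have "measure lebesgue (chart_map c ` E F) \<noteq> 0"
    using F(3) negligible_iff_measure0 by blast
  then have pos: "measure lebesgue (chart_map c ` E F) > 0"
    by (simp add: zero_less_measure_iff)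
  show thesis
  proof (rule that[OF C(1) EF pos F(1)])
    show "ch B \<in> A \<and> compact (K B) \<and> K B \<subseteq> chart_dom (ch B)" if "B \<in> F" for B
      using K F(2) that by blast
    show "(f ^^ k) q \<in> (\<Union>B\<in>F. K B)" if "q \<in> E F" for q k
      using that by (simp add: E_def)
  qed
qed

text \<open>
  Without returns after time \<open>N\<close> the images of a set \<open>E \<subseteq> U\<close> at times \<open>t j\<close> that differ by at
  least \<open>N\<close> are disjoint.
  Each of them, cut into finitely many pieces by the sets \<open>K B\<close>, has in charts at least a
  fixed fraction of the volume of \<open>E\<close>: the distortion estimate is applied to the inverse \<open>g\<close>,
  which maps the pieces back into \<open>E\<close>.
\<close>

lemma returns_to_open_set:
  assumes f: "continuous_on UNIV f" and g: "continuous_on UNIV g" "preserves_coeff A \<omega> g"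
    and fg: "\<And>x. g (f x) = x"
    and stable: "Lagrange_stable f" and U: "open U" "p \<in> U"
  shows "\<exists>k\<ge>N. \<exists>q\<in>U. (f ^^ k) q \<in> U"
proof (rule ccontr)
  assume "\<not> ?thesis"
  then have no_return: "(f ^^ k) q \<notin> U" if "k \<ge> N" "q \<in> U" for k q
    using that by blast
  obtain c E F ch K where c: "c \<in> A" and E: "compact E" "E \<subseteq> chart_dom c \<inter> U"
    and pos: "measure lebesgue (chart_map c ` E) > 0" and F: "finite F"
    and K: "\<And>B. B \<in> F \<Longrightarrow> ch B \<in> A \<and> compact (K B) \<and> K B \<subseteq> chart_dom (ch B)"
    and orbit: "\<And>q k. q \<in> E \<Longrightarrow> (f ^^ k) q \<in> (\<Union>B\<in>F. K (B :: 'a set))"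
    using bounded_orbits_of_positive_volume[OF f stable U] by metis
  let ?vol = "\<lambda>c S. measure lebesgue (chart_map c ` S)"
  have "\<exists>b\<ge>0. \<forall>x\<in>K B. \<forall>y\<in>E. \<bar>form_coeff A \<omega> (ch B) x\<bar> \<le> b * \<bar>form_coeff A \<omega> c y\<bar>" if "B \<in> F" for B
    using form_coeff_ratio_bounded[of c E "ch B" "K B"] c E K[OF that] by (metis Int_subset_iff)
  then obtain b where b: "\<And>B. B \<in> F \<Longrightarrow> b B \<ge> 0"
    "\<And>B x y. B \<in> F \<Longrightarrow> x \<in> K B \<Longrightarrow> y \<in> E \<Longrightarrow>
       \<bar>form_coeff A \<omega> (ch B) x\<bar> \<le> b B * \<bar>form_coeff A \<omega> c y\<bar>"
    by metis
  \<comment> \<open>Spaced by more than \<open>N\<close> and positive, since only positive powers of \<open>g\<close> are controlled.\<close>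
  define t where "t j = Suc N * Suc j" for j
  define P where "P j B = E \<inter> (f ^^ t j) -` K B" for j B
  define S where "S j B = (f ^^ t j) ` P j B" for j B
  have P: "compact (P j B)" if "B \<in> F" for j B
    unfolding P_def using E K[OF that] continuous_on_funpow[OF f]
    by (intro compact_Int_closed closed_vimage compact_imp_closed) auto
  have S: "compact (S j B)" "S j B \<subseteq> K B" if "B \<in> F" for j B
    unfolding S_def using P[OF that] continuous_on_funpow[OF f]
    by (auto intro!: compact_continuous_image intro: continuous_on_subset simp: P_def)
  have gS: "(g ^^ t j) ` S j B = P j B" for j B
    unfolding S_def by (simp add: image_image funpow_inverse[of g f, OF fg])
  have vol_P: "?vol c (P j B) \<le> b B * ?vol (ch B) (S j B)" if B: "B \<in> F" for j B
  proof -
    have "?vol c ((g ^^ t j) ` S j B) \<le> b B * ?vol (ch B) (S j B)"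
    proof (rule measure_chart_image_le)
      show "preserves_coeff A \<omega> (g ^^ t j)"
        using g by (intro preserves_coeff_funpow) (auto simp: t_def)
      show "continuous_on UNIV (g ^^ t j)"
        using g by (intro continuous_on_funpow)
      show "(g ^^ t j) ` S j B \<subseteq> chart_dom c"
        using E by (auto simp: gS P_def)
      show "S j B \<subseteq> chart_dom (ch B)"
        using S K B by blast
      show "\<bar>form_coeff A \<omega> (ch B) q\<bar> \<le> b B * \<bar>form_coeff A \<omega> c ((g ^^ t j) q)\<bar>" if "q \<in> S j B" for q
      proof (rule b(2)[OF B])
        show "q \<in> K B"
          using that S B by blast
        have "(g ^^ t j) q \<in> P j B"
          using that gS by blast
        then show "(g ^^ t j) q \<in> E"
          by (simp add: P_def)
      qed
    qed (use S K B c in auto)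
    then show ?thesis
      by (simp add: gS)
  qed
  have vol_E: "?vol c E \<le> (\<Sum>B\<in>F. b B * ?vol (ch B) (S j B))" for j
  proof -
    have comp: "compact (chart_map c ` P j B)" if "B \<in> F" for B
      using P[OF that] E c by (intro compact_chart_image) (auto simp: P_def)
    have "E = (\<Union>B\<in>F. P j B)"
      using orbit[of _ "t j"] by (auto simp: P_def)
    then have "?vol c E = measure lebesgue (\<Union>B\<in>F. chart_map c ` P j B)"
      by (metis image_UN)
    also have "\<dots> \<le> (\<Sum>B\<in>F. ?vol c (P j B))"
      using comp F by (intro measure_UNION_le fmeasurableD lmeasurable_compact) auto
    also have "\<dots> \<le> (\<Sum>B\<in>F. b B * ?vol (ch B) (S j B))"
      by (intro sum_mono vol_P)
    finally show ?thesis .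
  qed
  have disj: "S i B \<inter> S j B' = {}" if "i < j" for i j B B'
  proof (rule ccontr)
    assume "S i B \<inter> S j B' \<noteq> {}"
    then obtain x y where xy: "x \<in> E" "y \<in> E" "(f ^^ t i) x = (f ^^ t j) y"
      by (auto simp: S_def P_def)
    obtain d where d: "j = i + d" "d > 0"
      using \<open>i < j\<close> less_imp_add_positive by metis
    have "(f ^^ t i) x = (f ^^ t i) ((f ^^ (Suc N * d)) y)"
    proof -
      have "t j = t i + Suc N * d"
        by (simp add: t_def d algebra_simps)
      then show ?thesis
        using xy(3) by (simp only: funpow_add comp_apply)
    qed
    then have "x = (f ^^ (Suc N * d)) y"
      by (metis funpow_inverse[of g f, OF fg])
    moreover have "Suc N * d \<ge> N"
      using d by (cases d) auto
    ultimately show False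
      using no_return xy E by blast
  qed
  have packing: "(\<Sum>j<n. ?vol (ch B) (S j B)) \<le> ?vol (ch B) (K B)" if B: "B \<in> F" for B n
  proof -
    have comp: "compact (chart_map (ch B) ` S j B)" for j
      using S[OF B] K[OF B] by (intro compact_chart_image) auto
    have "chart_map (ch B) ` S i B \<inter> chart_map (ch B) ` S j B = {}" if "i \<noteq> j" for i j
    proof -
      have "S i B \<inter> S j B = {}"
        using disj[of i j B B] disj[of j i B B] \<open>i \<noteq> j\<close> by (metis Int_commute linorder_neqE_nat)
      moreover have "S i B \<subseteq> chart_dom (ch B)" "S j B \<subseteq> chart_dom (ch B)"
        using S[OF B] K[OF B] by blast+
      moreover have "inj_on (chart_map (ch B)) (chart_dom (ch B))"
        using K[OF B] inj_on_chart_map by blast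
      ultimately show ?thesis
        by (metis inj_on_image_Int image_empty)
    qed
    then have "(\<Sum>j<n. ?vol (ch B) (S j B)) = measure lebesgue (\<Union>j<n. chart_map (ch B) ` S j B)"
      using comp by (intro measure_UNION'[symmetric] lmeasurable_compact)
        (auto simp: pairwise_def disjnt_def)
    also have "\<dots> \<le> ?vol (ch B) (K B)"
    proof (rule measure_mono_fmeasurable)
      show "(\<Union>j<n. chart_map (ch B) ` S j B) \<subseteq> chart_map (ch B) ` K B"
        using S[OF B] by blast
      show "(\<Union>j<n. chart_map (ch B) ` S j B) \<in> sets lebesgue"
        using comp by (intro sets.finite_UN fmeasurableD lmeasurable_compact) auto
      show "chart_map (ch B) ` K B \<in> lmeasurable"
        using K[OF B] by (intro lmeasurable_compact compact_chart_image) auto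
    qed
    finally show ?thesis .
  qed
  have bounded: "real n * ?vol c E \<le> (\<Sum>B\<in>F. b B * ?vol (ch B) (K B))" for n
  proof -
    have "real n * ?vol c E = (\<Sum>j<n. ?vol c E)"
      by simp
    also have "\<dots> \<le> (\<Sum>j<n. \<Sum>B\<in>F. b B * ?vol (ch B) (S j B))"
      by (intro sum_mono vol_E)
    also have "\<dots> = (\<Sum>B\<in>F. b B * (\<Sum>j<n. ?vol (ch B) (S j B)))"
      by (subst sum.swap) (simp add: sum_distrib_left)
    also have "\<dots> \<le> (\<Sum>B\<in>F. b B * ?vol (ch B) (K B))"
      by (intro sum_mono mult_left_mono packing b)
    finally show ?thesis .
  qed
  obtain n where "(\<Sum>B\<in>F. b B * ?vol (ch B) (K B)) < real n * ?vol c E"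
    using ex_less_of_nat_mult[OF pos] by blast
  then show False
    using bounded[of n] by simp
qed

end

theorem theorem4p10:
  fixes A :: "('a::metric_space, 'n::finite) chart set"
    and \<omega> :: "('a, 'n) top_form"
    and f :: "'a \<Rightarrow> 'a"
  assumes "C1_manifold A"
    and "volume_form A \<omega>"
    and "C1_diffeomorphism A f"
    and "preserves_form A f \<omega>"
    and "Lagrange_stable f"
  shows "\<forall>p. strongly_chain_recurrent f p"
proof
  fix p
  interpret volume_manifold A \<omega>
    using assms by unfold_locales
  have f: "bij f" "C1_map A f" "C1_map A (inv f)"
    using assms by (auto simp: C1_diffeomorphism_def)
  have cont: "continuous_on UNIV f" "continuous_on UNIV (inv f)"
    using f by (simp_all add: C1_map_def)
  have inv: "f (inv f x) = x" "inv f (f x) = x" for x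
    using f by (simp_all add: bij_is_surj surj_f_inv_f bij_is_inj inv_f_f)
  have pres: "preserves_coeff A \<omega> (inv f)"
    by (rule preserves_coeff_inverse[OF preserves_coeff_if_preserves_form[OF f(2) assms(4)] f(3) inv(1)])
  show "strongly_chain_recurrent f p"
    by (rule strongly_chain_recurrent_if_returns[OF cont(1)])
      (rule returns_to_open_set[OF cont pres inv(2) assms(5)])
qed

end
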